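(* Let $\mathbf{I}\mathbb{N}_{\infty}$ be the monoid of all partial cofinite isometries of $\mathbb{N}$ and let $\mathscr{I}_{\infty}^{\nearrow}(\mathbb{N})$ be the monoid of all monotone cofinite partial bijections of $\mathbb{N}$. Then the following hold, where $\alpha,\beta$ are arbitrary elements of $\mathbf{I}\mathbb{N}_{\infty}$. (i) $E(\mathbf{I}\mathbb{N}_{\infty})=E(\mathscr{I}_{\infty}^{\nearrow}(\mathbb{N}))$ in $\mathscr{I}_{\infty}^{\nearrow}(\mathbb{N})$, and hence the semilattice $E(\mathbf{I}\mathbb{N}_{\infty})$ is isomorphic to the free semilattice with unit $(\mathscr{P}_{\infty}(\mathbb{N}),\cup)$; this isomorphism is given by the map $(\varepsilon)h=\mathbb{N}\setminus\operatorname{dom}\varepsilon$. (ii) If $\varepsilon,\iota\in E(\mathbf{I}\mathbb{N}_{\infty})$, then $\varepsilon\preccurlyeq\iota$ if and only if $\operatorname{dom}\varepsilon\subseteq\operatorname{dom}\iota$. (iii) Every maximal chain in the semilattice $E(\mathbf{I}\mathbb{N}_{\infty})$ is an $\omega$-chain. (iv) $\alpha\mathscr{L}\beta$ in $\mathbf{I}\mathbb{N}_{\infty}$ if and only if $\operatorname{dom}\alpha=\operatorname{dom}\beta$. (v) $\alpha\mathscr{R}\beta$ in $\mathbf{I}\mathbb{N}_{\infty}$ if and only if $\operatorname{ran}\alpha=\operatorname{ran}\beta$. (vi) $\alpha\mathscr{H}\beta$ in $\mathbf{I}\mathbb{N}_{\infty}$ if and only if $\alpha=\beta$. (vii) $\alpha\mathscr{D}\beta$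 in $\mathbf{I}\mathbb{N}_{\infty}$ if and only if $\operatorname{dom}\alpha$ is a shift of the set $\operatorname{dom}\beta$; likewise, $\alpha\mathscr{D}\beta$ in $\mathbf{I}\mathbb{N}_{\infty}$ if and only if $\operatorname{ran}\alpha$ is a shift of the set $\operatorname{ran}\beta$.
   Context: $\mathbb{N}=\{1,2,3,\ldots\}$ with the usual order and the metric $d(n,m)=|n-m|$. Partial maps are written on the right and composed from left to right: $(x)(\alpha\beta)=((x)\alpha)\beta$, with $\operatorname{dom}(\alpha\beta)=\{x\in\operatorname{dom}\alpha: (x)\alpha\in\operatorname{dom}\beta\}$. A partial injective map $\alpha:\mathbb{N}\rightharpoonup\mathbb{N}$ is cofinite if $\mathbb{N}\setminus\operatorname{dom}\alpha$ and $\mathbb{N}\setminus\operatorname{ran}\alpha$ are finite. $\mathbf{I}\mathbb{N}_{\infty}$ is the inverse monoid, under composition, of all cofinite partial maps $\alpha:\mathbb{N}\rightharpoonup\mathbb{N}$ with $|(x)\alpha-(y)\alpha|=|x-y|$ for all $x,y\in\operatorname{dom}\alpha$. $\mathscr{I}_{\infty}^{\nearrow}(\mathbb{N})$ is the monoid, under composition, of all cofinite partial injective maps $\alpha:\mathbb{N}\rightharpoonup\mathbb{N}$ that are monotone ($x\leqslant y$ implies $(x)\alpha\leqslant(y)\alpha$ on $\operatorname{dom}\alpha$). $E(S)$ is the set of idempotents of $S$, with natural partial order $e\preccurlyeq f$ iff $ef=fe=e$. $(\mathscr{P}_{\infty}(\mathbb{N}),\cup)$ is the set of all finite subsets of $\mathbb{N}$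 (including the empty set) under union. A chain is a linearly ordered set; an $\omega$-chain is a linearly ordered set order isomorphic to $(\mathbb{N},\geqslant)$. $\mathscr{L},\mathscr{R},\mathscr{H},\mathscr{D}$ are Green's relations on $S=\mathbf{I}\mathbb{N}_{\infty}$, with the letters $\mathscr{L}$ and $\mathscr{R}$ assigned as they are used in the source's arguments, where $\alpha\mathscr{L}\alpha\alpha^{-1}$ and $\beta\mathscr{R}\beta^{-1}\beta$: that is, $a\mathscr{L}b$ iff $aS=bS$ (equivalently $aa^{-1}=bb^{-1}$), and $a\mathscr{R}b$ iff $Sa=Sb$ (equivalently $a^{-1}a=b^{-1}b$). This assignment is opposite to the most common one. Further, $\mathscr{H}=\mathscr{L}\cap\mathscr{R}$ and $\mathscr{D}=\mathscr{L}\circ\mathscr{R}=\mathscr{R}\circ\mathscr{L}$. A set $A\subseteq\mathbb{N}$ is a shift of $B\subseteq\mathbb{N}$ if there is an integer $k$ with $A=\{b+k: b\in B\}$. *)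

theory Defs
  imports "HOL-Algebra.Coset" "HOL-Algebra.FiniteProduct"
begin

text \<open>The natural numbers start at 1 here.\<close>

abbreviation Npos :: "nat set"
  where "Npos \<equiv> {1..}"

definition cofinite_pinj :: "(nat \<rightharpoonup> nat) set"
  where "cofinite_pinj =
    {\<alpha>. dom \<alpha> \<subseteq> Npos \<and> ran \<alpha> \<subseteq> Npos \<and> inj_on \<alpha> (dom \<alpha>) \<and>
         finite (Npos - dom \<alpha>) \<and> finite (Npos - ran \<alpha>)}"

definition partial_isometry :: "(nat \<rightharpoonup> nat) \<Rightarrow> bool"
  where "partial_isometry \<alpha> \<longleftrightarrow>
    (\<forall>x\<in>dom \<alpha>. \<forall>y\<in>dom \<alpha>. \<bar>int (the (\<alpha> x)) - int (the (\<alpha> y))\<bar> = \<bar>int x - int y\<bar>)"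

definition partial_monotone :: "(nat \<rightharpoonup> nat) \<Rightarrow> bool"
  where "partial_monotone \<alpha> \<longleftrightarrow>
    (\<forall>x\<in>dom \<alpha>. \<forall>y\<in>dom \<alpha>. x \<le> y \<longrightarrow> the (\<alpha> x) \<le> the (\<alpha> y))"

text \<open>Maps act on the right: the product of \<open>\<alpha>\<close> and \<open>\<beta>\<close> applies \<open>\<alpha>\<close> first,
  whereas \<open>\<circ>\<^sub>m\<close> applies its right argument first.\<close>

definition pmap_monoid :: "(nat \<rightharpoonup> nat) set \<Rightarrow> (nat \<rightharpoonup> nat) monoid"
  where "pmap_monoid A =
    \<lparr>carrier = A, mult = (\<lambda>\<alpha> \<beta>. \<beta> \<circ>\<^sub>m \<alpha>), one = Some |` Npos\<rparr>"

definition IN_inf :: "(nat \<rightharpoonup> nat) monoid"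
  where "IN_inf = pmap_monoid {\<alpha> \<in> cofinite_pinj. partial_isometry \<alpha>}"

definition Imon_inf :: "(nat \<rightharpoonup> nat) monoid"
  where "Imon_inf = pmap_monoid {\<alpha> \<in> cofinite_pinj. partial_monotone \<alpha>}"

definition idempotents :: "('a, 'b) monoid_scheme \<Rightarrow> 'a set"
  where "idempotents S = {e \<in> carrier S. e \<otimes>\<^bsub>S\<^esub> e = e}"

definition idempotent_semilattice :: "('a, 'b) monoid_scheme \<Rightarrow> ('a, 'b) monoid_scheme"
  where "idempotent_semilattice S = S\<lparr>carrier := idempotents S\<rparr>"

definition natural_le :: "('a, 'b) monoid_scheme \<Rightarrow> 'a \<Rightarrow> 'a \<Rightarrow> bool"
  where "natural_le S e f \<longleftrightarrow> e \<otimes>\<^bsub>S\<^esub> f = e \<and> f \<otimes>\<^bsub>S\<^esub> e = e"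

definition fin_subsets_monoid :: "nat set monoid"
  where "fin_subsets_monoid =
    \<lparr>carrier = {A. A \<subseteq> Npos \<and> finite A}, mult = (\<union>), one = {}\<rparr>"

text \<open>Order isomorphic to \<open>(\<nat>, \<ge>)\<close>, so \<open>f 1\<close> is the greatest element of \<open>C\<close>.\<close>

definition omega_chain :: "('a \<Rightarrow> 'a \<Rightarrow> bool) \<Rightarrow> 'a set \<Rightarrow> bool"
  where "omega_chain r C \<longleftrightarrow>
    (\<exists>f. bij_betw f Npos C \<and> (\<forall>m\<in>Npos. \<forall>n\<in>Npos. m \<ge> n \<longleftrightarrow> r (f m) (f n)))"

text \<open>The letters \<open>L\<close> and \<open>R\<close> are deliberately swapped with respect to the usual
  convention: \<open>a L b\<close> means \<open>aS = bS\<close>, and \<open>a R b\<close> means \<open>Sa = Sb\<close>.\<close>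

definition green_L :: "('a, 'b) monoid_scheme \<Rightarrow> 'a rel"
  where "green_L S =
    {(a, b) \<in> carrier S \<times> carrier S. a <#\<^bsub>S\<^esub> carrier S = b <#\<^bsub>S\<^esub> carrier S}"

definition green_R :: "('a, 'b) monoid_scheme \<Rightarrow> 'a rel"
  where "green_R S =
    {(a, b) \<in> carrier S \<times> carrier S. carrier S #>\<^bsub>S\<^esub> a = carrier S #>\<^bsub>S\<^esub> b}"

definition green_H :: "('a, 'b) monoid_scheme \<Rightarrow> 'a rel"
  where "green_H S = green_L S \<inter> green_R S"

definition green_D :: "('a, 'b) monoid_scheme \<Rightarrow> 'a rel"
  where "green_D S = green_L S O green_R S"

text \<open>The shift amount may be negative, hence the embedding into the integers.\<close>

definition is_shift_of :: "nat set \<Rightarrow> nat set \<Rightarrow> bool"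
  where "is_shift_of A B \<longleftrightarrow> (\<exists>k::int. int ` A = {int b + k | b. b \<in> B})"

lemma cofinite_pinj_comp:
  assumes "\<alpha> \<in> cofinite_pinj" "\<beta> \<in> cofinite_pinj"
  shows "\<beta> \<circ>\<^sub>m \<alpha> \<in> cofinite_pinj"
proof -
  have dm: "dom (\<beta> \<circ>\<^sub>m \<alpha>) \<subseteq> dom \<alpha>" and rn: "ran (\<beta> \<circ>\<^sub>m \<alpha>) \<subseteq> ran \<beta>"
    by (auto simp: map_comp_def ran_def split: option.splits)
  have ia: "\<And>x y z. \<alpha> x = Some z \<Longrightarrow> \<alpha> y = Some z \<Longrightarrow> x = y"
    and ib: "\<And>x y z. \<beta> x = Some z \<Longrightarrow> \<beta> y = Some z \<Longrightarrow> x = y"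
    using assms unfolding cofinite_pinj_def by (auto simp: inj_on_def dom_def)
  have fin: "finite (Npos - dom \<alpha>)" "finite (Npos - ran \<alpha>)"
    "finite (Npos - dom \<beta>)" "finite (Npos - ran \<beta>)"
    using assms unfolding cofinite_pinj_def by auto
  have "inj_on (\<beta> \<circ>\<^sub>m \<alpha>) (dom (\<beta> \<circ>\<^sub>m \<alpha>))"
  proof (rule inj_onI)
    fix x y assume "x \<in> dom (\<beta> \<circ>\<^sub>m \<alpha>)" "(\<beta> \<circ>\<^sub>m \<alpha>) x = (\<beta> \<circ>\<^sub>m \<alpha>) y"
    then obtain z where "(\<beta> \<circ>\<^sub>m \<alpha>) x = Some z" "(\<beta> \<circ>\<^sub>m \<alpha>) y = Some z"
      by (metis domD)
    then obtain u v where "\<alpha> x = Some u" "\<alpha> y = Some v" "\<beta> u = Some z" "\<beta> v = Some z"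
      by (auto simp: map_comp_Some_iff)
    then show "x = y" using ia ib by metis
  qed
  moreover have "finite (Npos - dom (\<beta> \<circ>\<^sub>m \<alpha>))"
  proof -
    have "Npos - dom (\<beta> \<circ>\<^sub>m \<alpha>) \<subseteq>
        (Npos - dom \<alpha>) \<union> {x. \<exists>y \<in> Npos - dom \<beta>. \<alpha> x = Some y}"
      using assms unfolding cofinite_pinj_def
      by (fastforce simp: map_comp_def dom_def ran_def split: option.splits)
    moreover have "finite {x. \<exists>y \<in> Npos - dom \<beta>. \<alpha> x = Some y}"
    proof (rule finite_imageD)
      show "finite ((\<lambda>x. the (\<alpha> x)) ` {x. \<exists>y \<in> Npos - dom \<beta>. \<alpha> x = Some y})"
        by (rule finite_subset[OF _ fin(3)]) auto
      show "inj_on (\<lambda>x. the (\<alpha> x)) {x. \<exists>y \<in> Npos - dom \<beta>. \<alpha> x = Some y}"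
        by (rule inj_onI) (auto dest: ia)
    qed
    ultimately show ?thesis
      using fin by (meson finite_UnI finite_subset)
  qed
  moreover have "finite (Npos - ran (\<beta> \<circ>\<^sub>m \<alpha>))"
  proof -
    have "Npos - ran (\<beta> \<circ>\<^sub>m \<alpha>) \<subseteq>
        (Npos - ran \<beta>) \<union> (\<lambda>x. the (\<beta> x)) ` (Npos - ran \<alpha>)"
    proof
      fix z assume z: "z \<in> Npos - ran (\<beta> \<circ>\<^sub>m \<alpha>)"
      show "z \<in> (Npos - ran \<beta>) \<union> (\<lambda>x. the (\<beta> x)) ` (Npos - ran \<alpha>)"
      proof (cases "z \<in> ran \<beta>")
        case True
        then obtain y where y: "\<beta> y = Some z" by (auto simp: ran_def)
        have "y \<notin> ran \<alpha>"
        proof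
          assume "y \<in> ran \<alpha>"
          then obtain x where "\<alpha> x = Some y" by (auto simp: ran_def)
          then have "(\<beta> \<circ>\<^sub>m \<alpha>) x = Some z" using y by simp
          then show False using z by (auto simp: ran_def)
        qed
        moreover have "y \<in> Npos" using y assms unfolding cofinite_pinj_def by auto
        ultimately show ?thesis using y by force
      qed (use z in auto)
    qed
    then show ?thesis
      using fin by (meson finite_UnI finite_imageI finite_subset)
  qed
  ultimately show ?thesis
    using assms dm rn unfolding cofinite_pinj_def by auto
qed

lemma pmap_monoid_is_monoid:
  assumes "A \<subseteq> cofinite_pinj" "Some |` Npos \<in> A"
    and "\<And>\<alpha> \<beta>. \<alpha> \<in> A \<Longrightarrow> \<beta> \<in> A \<Longrightarrow> \<beta> \<circ>\<^sub>m \<alpha> \<in> A"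
  shows "monoid (pmap_monoid A)"
proof (rule monoidI)
  fix \<alpha> assume "\<alpha> \<in> carrier (pmap_monoid A)"
  then have "dom \<alpha> \<subseteq> Npos" "ran \<alpha> \<subseteq> Npos"
    using assms(1) by (auto simp: pmap_monoid_def cofinite_pinj_def)
  then have d: "x \<in> Npos" "y \<in> Npos" if "\<alpha> x = Some y" for x y
    using that by (auto simp: ran_def dom_def)
  have "(\<alpha> \<circ>\<^sub>m (Some |` Npos)) x = \<alpha> x" for x
    using d(1)[of x] by (cases "\<alpha> x") (auto simp: map_comp_def restrict_map_def)
  then show "\<one>\<^bsub>pmap_monoid A\<^esub> \<otimes>\<^bsub>pmap_monoid A\<^esub> \<alpha> = \<alpha>"
    by (auto simp: pmap_monoid_def)
  have "((Some |` Npos) \<circ>\<^sub>m \<alpha>) x = \<alpha> x" for x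
    using d(2)[of x] by (cases "\<alpha> x") (auto simp: map_comp_def restrict_map_def)
  then show "\<alpha> \<otimes>\<^bsub>pmap_monoid A\<^esub> \<one>\<^bsub>pmap_monoid A\<^esub> = \<alpha>"
    by (auto simp: pmap_monoid_def)
qed (use assms in \<open>auto simp: pmap_monoid_def map_comp_def split: option.splits\<close>)

lemma one_cofinite_pinj: "Some |` Npos \<in> cofinite_pinj"
proof -
  have "dom (Some |` Npos) = Npos" "ran (Some |` Npos) = Npos"
    by (auto simp: ran_def restrict_map_def split: if_splits)
  then show ?thesis
    unfolding cofinite_pinj_def by (auto simp: inj_on_def restrict_map_def)
qed

lemma monoid_IN_inf: "monoid IN_inf"
  unfolding IN_inf_def
proof (rule pmap_monoid_is_monoid)
  show "Some |` Npos \<in> {\<alpha> \<in> cofinite_pinj. partial_isometry \<alpha>}"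
    using one_cofinite_pinj by (auto simp: partial_isometry_def)
  fix \<alpha> \<beta>
  assume "\<alpha> \<in> {\<alpha> \<in> cofinite_pinj. partial_isometry \<alpha>}"
    and "\<beta> \<in> {\<alpha> \<in> cofinite_pinj. partial_isometry \<alpha>}"
  then have c: "\<alpha> \<in> cofinite_pinj" "\<beta> \<in> cofinite_pinj"
    and a: "partial_isometry \<alpha>" and b: "partial_isometry \<beta>" by auto
  have "partial_isometry (\<beta> \<circ>\<^sub>m \<alpha>)"
    unfolding partial_isometry_def
  proof (intro ballI)
    fix x y assume xy: "x \<in> dom (\<beta> \<circ>\<^sub>m \<alpha>)" "y \<in> dom (\<beta> \<circ>\<^sub>m \<alpha>)"
    then obtain u v where uv: "\<alpha> x = Some u" "\<alpha> y = Some v" "u \<in> dom \<beta>" "v \<in> dom \<beta>"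
      by (auto simp: map_comp_Some_iff dom_def)
    have "\<bar>int u - int v\<bar> = \<bar>int x - int y\<bar>"
      using a uv(1,2) unfolding partial_isometry_def by (metis domI option.sel)
    moreover have "\<bar>int (the (\<beta> u)) - int (the (\<beta> v))\<bar> = \<bar>int u - int v\<bar>"
      using b uv(3,4) unfolding partial_isometry_def by blast
    ultimately show "\<bar>int (the ((\<beta> \<circ>\<^sub>m \<alpha>) x)) - int (the ((\<beta> \<circ>\<^sub>m \<alpha>) y))\<bar> = \<bar>int x - int y\<bar>"
      using uv by simp
  qed
  then show "\<beta> \<circ>\<^sub>m \<alpha> \<in> {\<alpha> \<in> cofinite_pinj. partial_isometry \<alpha>}"
    using cofinite_pinj_comp[OF c] by simp
qed auto

lemma monoid_Imon_inf: "monoid Imon_inf"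
  unfolding Imon_inf_def
proof (rule pmap_monoid_is_monoid)
  show "Some |` Npos \<in> {\<alpha> \<in> cofinite_pinj. partial_monotone \<alpha>}"
    using one_cofinite_pinj by (auto simp: partial_monotone_def)
  fix \<alpha> \<beta>
  assume "\<alpha> \<in> {\<alpha> \<in> cofinite_pinj. partial_monotone \<alpha>}"
    and "\<beta> \<in> {\<alpha> \<in> cofinite_pinj. partial_monotone \<alpha>}"
  then have c: "\<alpha> \<in> cofinite_pinj" "\<beta> \<in> cofinite_pinj"
    and a: "partial_monotone \<alpha>" and b: "partial_monotone \<beta>" by auto
  have "partial_monotone (\<beta> \<circ>\<^sub>m \<alpha>)"
    unfolding partial_monotone_def
  proof (intro ballI impI)
    fix x y assume xy: "x \<in> dom (\<beta> \<circ>\<^sub>m \<alpha>)" "y \<in> dom (\<beta> \<circ>\<^sub>m \<alpha>)" "x \<le> y"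
    then obtain u v where uv: "\<alpha> x = Some u" "\<alpha> y = Some v" "u \<in> dom \<beta>" "v \<in> dom \<beta>"
      by (auto simp: map_comp_Some_iff dom_def)
    have "u \<le> v"
      using a uv(1,2) xy(3) unfolding partial_monotone_def by (metis domI option.sel)
    then have "the (\<beta> u) \<le> the (\<beta> v)"
      using b uv(3,4) unfolding partial_monotone_def by blast
    then show "the ((\<beta> \<circ>\<^sub>m \<alpha>) x) \<le> the ((\<beta> \<circ>\<^sub>m \<alpha>) y)"
      using uv by simp
  qed
  then show "\<beta> \<circ>\<^sub>m \<alpha> \<in> {\<alpha> \<in> cofinite_pinj. partial_monotone \<alpha>}"
    using cofinite_pinj_comp[OF c] by simp
qed auto

lemma (in monoid) green_D_commute: "green_D G = green_R G O green_L G"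
proof -
  have L: "(a, b) \<in> green_L G \<longleftrightarrow>
      (a \<in> carrier G \<and> b \<in> carrier G \<and>
       (\<exists>u\<in>carrier G. a = b \<otimes> u) \<and> (\<exists>v\<in>carrier G. b = a \<otimes> v))" for a b
  proof
    assume "(a, b) \<in> green_L G"
    then have c: "a \<in> carrier G" "b \<in> carrier G" "a <# carrier G = b <# carrier G"
      by (auto simp: green_L_def)
    have "a \<in> a <# carrier G" "b \<in> b <# carrier G"
      using c(1,2) by (auto simp: l_coset_def intro!: bexI[of _ "\<one>"])
    then show "a \<in> carrier G \<and> b \<in> carrier G \<and>
       (\<exists>u\<in>carrier G. a = b \<otimes> u) \<and> (\<exists>v\<in>carrier G. b = a \<otimes> v)"
      using c by (auto simp: l_coset_def)
  next
    assume "a \<in> carrier G \<and> b \<in> carrier G \<and>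
       (\<exists>u\<in>carrier G. a = b \<otimes> u) \<and> (\<exists>v\<in>carrier G. b = a \<otimes> v)"
    then obtain u v where c: "a \<in> carrier G" "b \<in> carrier G"
      and u: "u \<in> carrier G" "a = b \<otimes> u" and v: "v \<in> carrier G" "b = a \<otimes> v" by blast
    have "a \<otimes> x \<in> b <# carrier G" if "x \<in> carrier G" for x
    proof -
      have "a \<otimes> x = b \<otimes> (u \<otimes> x)" using m_assoc[OF c(2) u(1) that] u(2) by simp
      then show ?thesis using u(1) that by (auto simp: l_coset_def)
    qed
    moreover have "b \<otimes> x \<in> a <# carrier G" if "x \<in> carrier G" for x
    proof -
      have "b \<otimes> x = a \<otimes> (v \<otimes> x)" using m_assoc[OF c(1) v(1) that] v(2) by simp
      then show ?thesis using v(1) that by (auto simp: l_coset_def)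
    qed
    ultimately have "a <# carrier G = b <# carrier G" by (fastforce simp: l_coset_def)
    then show "(a, b) \<in> green_L G" using c by (simp add: green_L_def)
  qed
  have R: "(a, b) \<in> green_R G \<longleftrightarrow>
      (a \<in> carrier G \<and> b \<in> carrier G \<and>
       (\<exists>u\<in>carrier G. a = u \<otimes> b) \<and> (\<exists>v\<in>carrier G. b = v \<otimes> a))" for a b
  proof
    assume "(a, b) \<in> green_R G"
    then have c: "a \<in> carrier G" "b \<in> carrier G" "carrier G #> a = carrier G #> b"
      by (auto simp: green_R_def)
    have "a \<in> carrier G #> a" "b \<in> carrier G #> b"
      using c(1,2) by (auto simp: r_coset_def intro!: bexI[of _ "\<one>"])
    then show "a \<in> carrier G \<and> b \<in> carrier G \<and>
       (\<exists>u\<in>carrier G. a = u \<otimes> b) \<and> (\<exists>v\<in>carrier G. b = v \<otimes> a)"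
      using c by (auto simp: r_coset_def)
  next
    assume "a \<in> carrier G \<and> b \<in> carrier G \<and>
       (\<exists>u\<in>carrier G. a = u \<otimes> b) \<and> (\<exists>v\<in>carrier G. b = v \<otimes> a)"
    then obtain u v where c: "a \<in> carrier G" "b \<in> carrier G"
      and u: "u \<in> carrier G" "a = u \<otimes> b" and v: "v \<in> carrier G" "b = v \<otimes> a" by blast
    have "x \<otimes> a \<in> carrier G #> b" if "x \<in> carrier G" for x
    proof -
      have "x \<otimes> a = (x \<otimes> u) \<otimes> b" using m_assoc[OF that u(1) c(2)] u(2) by simp
      then show ?thesis using u(1) that by (auto simp: r_coset_def)
    qed
    moreover have "x \<otimes> b \<in> carrier G #> a" if "x \<in> carrier G" for x
    proof -
      have "x \<otimes> b = (x \<otimes> v) \<otimes> a" using m_assoc[OF that v(1) c(1)] v(2) by simp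
      then show ?thesis using v(1) that by (auto simp: r_coset_def)
    qed
    ultimately have "carrier G #> a = carrier G #> b" by (fastforce simp: r_coset_def)
    then show "(a, b) \<in> green_R G" using c by (simp add: green_R_def)
  qed
  have 1: "\<exists>d. (a, d) \<in> green_R G \<and> (d, b) \<in> green_L G"
    if ac: "(a, c) \<in> green_L G" and cb: "(c, b) \<in> green_R G" for a b c
  proof -
    obtain u v where u: "u \<in> carrier G" "a = c \<otimes> u" and v: "v \<in> carrier G" "c = a \<otimes> v"
      using ac L by blast
    obtain s t where s: "s \<in> carrier G" "c = s \<otimes> b" and t: "t \<in> carrier G" "b = t \<otimes> c"
      using cb R by blast
    have car: "a \<in> carrier G" "b \<in> carrier G" "c \<in> carrier G" using ac cb L R by auto
    have 1: "b \<otimes> u = t \<otimes> a"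
      using m_assoc[OF t(1) car(3) u(1)] t(2) u(2) by simp
    have 2: "a = s \<otimes> (b \<otimes> u)"
      using m_assoc[OF s(1) car(2) u(1)] s(2) u(2) by simp
    have "(b \<otimes> u) \<otimes> v = t \<otimes> (a \<otimes> v)" using m_assoc[OF t(1) car(1) v(1)] 1 by simp
    also have "\<dots> = b" using t(2) v(2) by simp
    finally have 3: "b = (b \<otimes> u) \<otimes> v" by (rule sym)
    have bu: "b \<otimes> u \<in> carrier G" using u car by simp
    have "(a, b \<otimes> u) \<in> green_R G" unfolding R using 1 2 s(1) t(1) car bu by blast
    moreover have "(b \<otimes> u, b) \<in> green_L G" unfolding L using 3 u(1) v(1) car bu by blast
    ultimately show ?thesis by blast
  qed
  have 2: "\<exists>d. (a, d) \<in> green_L G \<and> (d, b) \<in> green_R G"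
    if ac: "(a, c) \<in> green_R G" and cb: "(c, b) \<in> green_L G" for a b c
  proof -
    have "(b, c) \<in> green_L G" "(c, a) \<in> green_R G"
      using that by (auto simp: green_L_def green_R_def)
    from 1[OF this] show ?thesis by (auto simp: green_L_def green_R_def)
  qed
  show ?thesis unfolding green_D_def using 1 2 by fast
qed

text \<open>The finite subsets under union form the free semilattice with unit over \<open>Npos\<close>.\<close>

lemma fin_subsets_monoid_free:
  fixes M (structure)
  assumes "comm_monoid M" and idem: "\<And>x. x \<in> carrier M \<Longrightarrow> x \<otimes> x = x"
    and f: "f \<in> Npos \<rightarrow> carrier M"
  shows "\<exists>!g. g \<in> extensional (carrier fin_subsets_monoid) \<and> g \<in> hom fin_subsets_monoid M \<and>
    g \<one>\<^bsub>fin_subsets_monoid\<^esub> = \<one> \<and> (\<forall>n\<in>Npos. g {n} = f n)"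
proof -
  interpret comm_monoid M by fact
  let ?P = "{A. A \<subseteq> Npos \<and> finite A}"
  have cl: "finprod M f A \<in> carrier M" if "A \<in> ?P" for A
    using that f by (intro finprod_closed) auto
  have un: "finprod M f (A \<union> B) = finprod M f A \<otimes> finprod M f B"
    if A: "A \<in> ?P" and B: "B \<in> ?P" for A B
  proof -
    from A have "finite A" "A \<subseteq> Npos" by auto
    then show ?thesis
    proof (induction A)
      case empty
      then show ?case using cl[OF B] by simp
    next
      case (insert a A)
      have AB: "A \<union> B \<in> ?P" "A \<in> ?P" and fa: "f a \<in> carrier M"
        using insert B f by auto
      have e: "finprod M f (insert a A) = f a \<otimes> finprod M f A"
        using insert f by (subst finprod_insert) auto
      have ih: "finprod M f (A \<union> B) = finprod M f A \<otimes> finprod M f B"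
        using insert by auto
      show ?case
      proof (cases "a \<in> B")
        case False
        then have "finprod M f (insert a (A \<union> B)) = f a \<otimes> finprod M f (A \<union> B)"
          using insert AB fa f by (subst finprod_insert) auto
        then show ?thesis using e ih fa cl[OF AB(2)] cl[OF B] by (simp add: m_assoc)
      next
        case True
        have i: "insert a (A \<union> B) = A \<union> B" using True by auto
        have B': "B - {a} \<in> ?P" using B by auto
        have "B = insert a (B - {a})" using True by auto
        then have "finprod M f B = finprod M f (insert a (B - {a}))" by simp
        also have "\<dots> = f a \<otimes> finprod M f (B - {a})"
          using B' fa f by (subst finprod_insert) auto
        finally have "f a \<otimes> finprod M f B = finprod M f B"
          using idem[OF fa] fa cl[OF B'] by (simp add: m_assoc[symmetric])
        then have "finprod M f A \<otimes> finprod M f B =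
            f a \<otimes> finprod M f A \<otimes> finprod M f B"
          using fa cl[OF AB(2)] cl[OF B] by (metis m_assoc m_comm)
        then show ?thesis using i e ih by simp
      qed
    qed
  qed
  show ?thesis
  proof (rule ex1I[of _ "restrict (finprod M f) ?P"])
    show "restrict (finprod M f) ?P \<in> extensional (carrier fin_subsets_monoid) \<and>
      restrict (finprod M f) ?P \<in> hom fin_subsets_monoid M \<and>
      restrict (finprod M f) ?P \<one>\<^bsub>fin_subsets_monoid\<^esub> = \<one> \<and>
      (\<forall>n\<in>Npos. restrict (finprod M f) ?P {n} = f n)"
    proof (intro conjI ballI)
      show "restrict (finprod M f) ?P \<in> hom fin_subsets_monoid M"
        using un cl by (auto simp: hom_def fin_subsets_monoid_def)
      fix n :: nat assume "n \<in> Npos"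
      then show "restrict (finprod M f) ?P {n} = f n"
        using f by (auto simp: Pi_iff)
    qed (auto simp: fin_subsets_monoid_def)
  next
    fix g
    assume "g \<in> extensional (carrier fin_subsets_monoid) \<and> g \<in> hom fin_subsets_monoid M \<and>
      g \<one>\<^bsub>fin_subsets_monoid\<^esub> = \<one> \<and> (\<forall>n\<in>Npos. g {n} = f n)"
    then have ge: "g \<in> extensional ?P" and g0: "g {} = \<one>" and g1: "\<And>n. n \<in> Npos \<Longrightarrow> g {n} = f n"
      and gu: "\<And>A B. A \<in> ?P \<Longrightarrow> B \<in> ?P \<Longrightarrow> g (A \<union> B) = g A \<otimes> g B"
      by (auto simp: fin_subsets_monoid_def hom_def)
    have "g A = finprod M f A" if "finite A" "A \<subseteq> Npos" for A
      using that
    proof (induction A)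
      case empty
      then show ?case using g0 by simp
    next
      case (insert a A)
      have "g ({a} \<union> A) = f a \<otimes> g A" using gu[of "{a}" A] g1 insert by auto
      moreover have "finprod M f (insert a A) = f a \<otimes> finprod M f A"
        using insert f by (subst finprod_insert) auto
      ultimately show ?case using insert by auto
    qed
    then show "g = restrict (finprod M f) ?P"
      using ge by (intro extensionalityI[of _ ?P]) auto
  qed
qed

end

theory Submission
  imports Defs
begin

text \<open>The theorem rests on a normal form. A cofinite partial isometry of the positive integers
  cannot reverse orientation, because its domain is unbounded above while its values are bounded
  below; hence it is the restriction of a translation \<open>x \<mapsto> x + k\<close>
  (\<open>carrier_IN_inf_translation\<close>). Conversely, a translation carrying one cofinite set onto
  another is an element of the monoid (\<open>translation_in_carrier\<close>).

  Consequently the Green relations only see domains and ranges. If \<open>\<alpha>\<close> and \<open>\<beta>\<close> share their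
  domain, then \<open>\<alpha> = \<beta>\<gamma>\<close> where \<open>\<gamma>\<close> translates \<open>ran \<beta>\<close> onto \<open>ran \<alpha>\<close>, and dually for
  ranges. A translation amount is determined by the least elements of domain and range, so the
  intersection of both relations is equality. Composing them, \<open>\<alpha> \<D> \<beta>\<close> asks for an
  element from \<open>dom \<alpha>\<close> onto \<open>ran \<beta>\<close>, that is, for these two sets to be shifts of each
  other; since domain and range of one element are shifts of each other, this is a condition on the
  two domains, or on the two ranges.

  An injective idempotent is the identity on its domain, and the identities on cofinite sets are both
  isometric and monotone. So the idempotents of both monoids are the same, and complementation
  turns them into the finite subsets, with the order reversed. A maximal chain of
  finite subsets of an infinite set has exactly one member of each finite cardinality
  (\<open>maximal_chain_bij_card\<close>), which is the required enumeration.\<close>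

section \<open>Idempotents\<close>

lemma mult_pmap [simp]:
  "\<alpha> \<otimes>\<^bsub>IN_inf\<^esub> \<beta> = \<beta> \<circ>\<^sub>m \<alpha>" "\<alpha> \<otimes>\<^bsub>Imon_inf\<^esub> \<beta> = \<beta> \<circ>\<^sub>m \<alpha>"
  by (simp_all add: IN_inf_def Imon_inf_def pmap_monoid_def)

lemma carrier_IN_inf: "carrier IN_inf = {\<alpha> \<in> cofinite_pinj. partial_isometry \<alpha>}"
  and carrier_Imon_inf: "carrier Imon_inf = {\<alpha> \<in> cofinite_pinj. partial_monotone \<alpha>}"
  by (simp_all add: IN_inf_def Imon_inf_def pmap_monoid_def)

lemma dom_Some_restrict [simp]: "dom (Some |` A) = A"
  by (auto simp: restrict_map_def split: if_splits)

lemma ran_Some_restrict [simp]: "ran (Some |` A) = A"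
  by (auto simp: restrict_map_def ran_def split: if_splits)

lemma comp_Some_restrict: "(Some |` B) \<circ>\<^sub>m (Some |` A) = Some |` (A \<inter> B)"
  by (auto simp: restrict_map_def map_comp_def)

lemma injective_idempotent_map:
  assumes "inj_on \<alpha> (dom \<alpha>)" "\<alpha> \<circ>\<^sub>m \<alpha> = \<alpha>"
  shows "\<alpha> = Some |` dom \<alpha>"
proof
  fix x
  show "\<alpha> x = (Some |` dom \<alpha>) x"
  proof (cases "\<alpha> x")
    case None
    then show ?thesis by (simp add: restrict_map_def domIff)
  next
    case (Some y)
    have "(\<alpha> \<circ>\<^sub>m \<alpha>) x = Some y" using assms(2) Some by simp
    then have "\<alpha> y = Some y" using Some by simp
    then have "x = y" using assms(1) Some by (metis domI inj_onD)
    then show ?thesis using Some by (simp add: restrict_map_def domI)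
  qed
qed

definition cofinite_identities :: "(nat \<rightharpoonup> nat) set"
  where "cofinite_identities = {Some |` A |A. A \<subseteq> Npos \<and> finite (Npos - A)}"

lemma cofinite_identities_subset:
  assumes "\<epsilon> \<in> cofinite_identities"
  shows "\<epsilon> \<in> cofinite_pinj" "partial_isometry \<epsilon>" "partial_monotone \<epsilon>"
    "\<epsilon> \<circ>\<^sub>m \<epsilon> = \<epsilon>"
proof -
  obtain A where A: "\<epsilon> = Some |` A" "A \<subseteq> Npos" "finite (Npos - A)"
    using assms by (auto simp: cofinite_identities_def)
  have "inj_on (Some |` A) A" by (auto simp: inj_on_def restrict_map_def)
  then show "\<epsilon> \<in> cofinite_pinj" using A by (simp add: cofinite_pinj_def)
  show "partial_isometry \<epsilon>" using A by (auto simp: partial_isometry_def)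
  show "partial_monotone \<epsilon>" using A by (auto simp: partial_monotone_def)
  show "\<epsilon> \<circ>\<^sub>m \<epsilon> = \<epsilon>" using A by (simp add: comp_Some_restrict)
qed

lemma cofinite_pinj_idempotent:
  assumes "\<epsilon> \<in> cofinite_pinj" "\<epsilon> \<circ>\<^sub>m \<epsilon> = \<epsilon>"
  shows "\<epsilon> \<in> cofinite_identities"
  using assms injective_idempotent_map[of \<epsilon>]
  by (auto simp: cofinite_identities_def cofinite_pinj_def)

lemma idempotents_IN_inf: "idempotents IN_inf = cofinite_identities"
  and idempotents_Imon_inf: "idempotents Imon_inf = cofinite_identities"
  by (auto simp: idempotents_def carrier_IN_inf carrier_Imon_inf
      intro: cofinite_pinj_idempotent cofinite_identities_subset)

lemma cofinite_identitiesD: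
  assumes "\<epsilon> \<in> cofinite_identities"
  shows "\<epsilon> = Some |` dom \<epsilon>" "dom \<epsilon> \<subseteq> Npos" "finite (Npos - dom \<epsilon>)"
proof -
  obtain A where "\<epsilon> = Some |` A" "A \<subseteq> Npos" "finite (Npos - A)"
    using assms by (auto simp: cofinite_identities_def)
  then show "\<epsilon> = Some |` dom \<epsilon>" "dom \<epsilon> \<subseteq> Npos" "finite (Npos - dom \<epsilon>)"
    by simp_all
qed

lemma cofinite_identitiesI:
  "A \<subseteq> Npos \<Longrightarrow> finite (Npos - A) \<Longrightarrow> Some |` A \<in> cofinite_identities"
  by (auto simp: cofinite_identities_def)

lemma bij_betw_complement_dom:
  "bij_betw (\<lambda>\<epsilon>. Npos - dom \<epsilon>) cofinite_identities {A. A \<subseteq> Npos \<and> finite A}"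
proof (rule bij_betw_byWitness[where f' = "\<lambda>A. Some |` (Npos - A)"])
  show "\<forall>\<epsilon>\<in>cofinite_identities. Some |` (Npos - (Npos - dom \<epsilon>)) = \<epsilon>"
    by (metis cofinite_identitiesD(1,2) double_diff subset_refl)
qed (auto simp: cofinite_identities_def Diff_Diff_Int Int_absorb1)

lemma complement_dom_iso:
  "(\<lambda>\<epsilon>. Npos - dom \<epsilon>) \<in> iso (idempotent_semilattice IN_inf) fin_subsets_monoid"
proof -
  have "Npos - dom (\<iota> \<circ>\<^sub>m \<epsilon>) = (Npos - dom \<epsilon>) \<union> (Npos - dom \<iota>)"
    if "\<epsilon> \<in> cofinite_identities" "\<iota> \<in> cofinite_identities" for \<epsilon> \<iota>
  proof -
    have "dom (\<iota> \<circ>\<^sub>m \<epsilon>) = dom \<epsilon> \<inter> dom \<iota>"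
      using that by (metis cofinite_identitiesD(1) comp_Some_restrict dom_Some_restrict)
    then show ?thesis by blast
  qed
  then show ?thesis
    using bij_betw_complement_dom cofinite_identitiesD(3)
    by (simp add: iso_def hom_def idempotent_semilattice_def idempotents_IN_inf
        fin_subsets_monoid_def Pi_iff)
qed

lemma natural_le_iff_dom_subset:
  assumes "\<epsilon> \<in> cofinite_identities" "\<iota> \<in> cofinite_identities"
  shows "natural_le IN_inf \<epsilon> \<iota> \<longleftrightarrow> dom \<epsilon> \<subseteq> dom \<iota>"
proof -
  obtain A B where "\<epsilon> = Some |` A" "\<iota> = Some |` B"
    using assms cofinite_identitiesD(1) by blast
  moreover have "Some |` (A \<inter> B) = Some |` A \<longleftrightarrow> A \<subseteq> B" for A B :: "nat set"
    by (metis dom_Some_restrict inf.order_iff)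
  ultimately show ?thesis
    by (auto simp: natural_le_def comp_Some_restrict Int_commute)
qed

section \<open>Maximal chains of finite sets\<close>

text \<open>If no member had \<open>n\<close> elements, the members would split into smaller ones, with union \<open>L\<close>,
  and larger ones, with intersection \<open>H\<close>. The set \<open>L\<close> has at most \<open>n\<close> elements and \<open>H\<close> at least
  \<open>n\<close>, so an \<open>n\<close>-element set fits between them and would extend the chain. In this form the
  argument also covers the cases in which there are no smaller or no larger members.\<close>

lemma maximal_chain_bij_card:
  fixes X :: "'a set"
  assumes X: "infinite X"
    and F: "\<And>A. A \<in> F \<Longrightarrow> A \<subseteq> X \<and> finite A"
    and chain: "\<And>A B. A \<in> F \<Longrightarrow> B \<in> F \<Longrightarrow> A \<subseteq> B \<or> B \<subseteq> A"
    and max: "\<And>D. D \<subseteq> X \<Longrightarrow> finite D \<Longrightarrow> (\<And>A. A \<in> F \<Longrightarrow> A \<subseteq> D \<or> D \<subseteq> A) \<Longrightarrow> D \<in> F"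
  shows "bij_betw card F UNIV"
proof -
  have "\<exists>A\<in>F. card A = n" for n
  proof (rule ccontr)
    assume none: "\<not> (\<exists>A\<in>F. card A = n)"
    define L where "L = \<Union>{A \<in> F. card A < n}"
    define H where "H = X \<inter> \<Inter>{A \<in> F. n < card A}"
    have sub: "A \<subseteq> B" if "A \<in> F" "B \<in> F" "card A < card B" for A B
      using chain[OF that(1,2)] F that by (meson card_mono leD)
    have LH: "L \<subseteq> H"
      unfolding L_def H_def using F sub by fastforce
    have L: "finite L \<and> card L \<le> n"
    proof (cases "{A \<in> F. card A < n} = {}")
      case True
      then have "L = {}" unfolding L_def by blast
      then show ?thesis by simp
    next
      case False
      have "\<exists>M. M \<in> F \<and> card M < n \<and> (\<forall>A. A \<in> F \<and> card A < n \<longrightarrow> card A \<le> card M)"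
        using ex_has_greatest_nat[of "\<lambda>A. A \<in> F \<and> card A < n" _ card n] False by fastforce
      then obtain M where M: "M \<in> F" "card M < n"
        and Mmax: "\<And>A. A \<in> F \<Longrightarrow> card A < n \<Longrightarrow> card A \<le> card M" by blast
      have "A \<subseteq> M" if "A \<in> F" "card A < n" for A
        using chain[OF that(1) M(1)] Mmax[OF that] F[OF that(1)] card_seteq[of A M] by blast
      then have "L \<subseteq> M" unfolding L_def by blast
      then show ?thesis
        using F[OF M(1)] M(2) card_mono[of M L] finite_subset by fastforce
    qed
    have H: "infinite H \<or> n \<le> card H"
    proof (cases "{A \<in> F. n < card A} = {}")
      case True
      then have "H = X" unfolding H_def by blast
      then show ?thesis using X by simp
    next
      case False
      have "\<exists>M. (M \<in> F \<and> n < card M) \<and> (\<forall>A. A \<in> F \<and> n < card A \<longrightarrow> card M \<le> card A)"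
        using ex_has_least_nat[of "\<lambda>A. A \<in> F \<and> n < card A" _ card] False by fastforce
      then obtain M where M: "M \<in> F" "n < card M"
        and Mmin: "\<And>A. A \<in> F \<Longrightarrow> n < card A \<Longrightarrow> card M \<le> card A" by blast
      have "M \<subseteq> A" if "A \<in> F" "n < card A" for A
        using chain[OF that(1) M(1)] Mmin[OF that] F[OF M(1)] card_seteq[of M A] by blast
      then have "M \<subseteq> H" unfolding H_def using F[OF M(1)] by blast
      then show ?thesis using M(2) card_mono[of H M] by fastforce
    qed
    obtain D where D: "L \<subseteq> D" "D \<subseteq> H" "finite D" "card D = n"
    proof (cases "finite H")
      case True
      then show ?thesis
        using exists_subset_between[of L n H] LH L H that finite_subset by blast
    next
      case False
      then have "infinite (H - L)" using L by simp
      then obtain E where E: "finite E" "card E = n - card L" "E \<subseteq> H - L"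
        using infinite_arbitrarily_large by blast
      then have "card (L \<union> E) = n" using L by (subst card_Un_disjoint) auto
      then show ?thesis using that[of "L \<union> E"] E L LH by blast
    qed
    have "A \<subseteq> D \<or> D \<subseteq> A" if "A \<in> F" for A
    proof -
      have "card A < n \<or> n < card A" using none that by (meson linorder_neqE_nat)
      then show ?thesis using D(1,2) that unfolding L_def H_def by blast
    qed
    moreover have "D \<subseteq> X" using D(2) unfolding H_def by blast
    ultimately have "D \<in> F" using max D(3) by blast
    then show False using none D(4) by blast
  qed
  moreover have "inj_on card F"
    by (rule inj_onI) (metis F chain card_subset_eq)
  ultimately show ?thesis unfolding bij_betw_def by (metis UNIV_eq_I image_eqI)
qed

lemma maxchain_idempotents_omega_chain:
  assumes "pred_on.maxchain cofinite_identities (natural_le IN_inf) C"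
  shows "omega_chain (natural_le IN_inf) C"
proof -
  let ?r = "natural_le IN_inf" and ?E = cofinite_identities
  let ?h = "\<lambda>\<epsilon> :: nat \<rightharpoonup> nat. Npos - dom \<epsilon>"
  have ch: "pred_on.chain ?E ?r C"
    and mx: "\<And>S. pred_on.chain ?E ?r S \<Longrightarrow> \<not> C \<subset> S"
    using assms by (auto simp: pred_on.maxchain_def)
  have CE: "C \<subseteq> ?E" using ch by (simp add: pred_on.chain_def)
  have le: "?r \<epsilon> \<iota> \<longleftrightarrow> ?h \<iota> \<subseteq> ?h \<epsilon>"
    if "\<epsilon> \<in> ?E" "\<iota> \<in> ?E" for \<epsilon> \<iota>
    using natural_le_iff_dom_subset[OF that] cofinite_identitiesD(2)[OF that(1)] by blast
  have cmp: "?r \<epsilon> \<iota> \<or> ?r \<iota> \<epsilon>" if "\<epsilon> \<in> C" "\<iota> \<in> C" for \<epsilon> \<iota>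
  proof -
    have "?r \<epsilon> \<epsilon>" using le[of \<epsilon> \<epsilon>] CE that by blast
    then show ?thesis using ch that unfolding pred_on.chain_def by fastforce
  qed
  have F: "A \<subseteq> Npos \<and> finite A" if "A \<in> ?h ` C" for A
    using that CE cofinite_identitiesD(3) by blast
  have chain: "A \<subseteq> B \<or> B \<subseteq> A" if "A \<in> ?h ` C" "B \<in> ?h ` C" for A B
    using that cmp le CE by blast
  have bij: "bij_betw card (?h ` C) UNIV"
  proof (rule maximal_chain_bij_card[OF infinite_Ici F chain])
    fix D assume D: "D \<subseteq> Npos" "finite D"
      and comp: "\<And>A. A \<in> ?h ` C \<Longrightarrow> A \<subseteq> D \<or> D \<subseteq> A"
    define \<delta> where "\<delta> = Some |` (Npos - D)"
    have hd: "?h \<delta> = D" using D by (auto simp: \<delta>_def)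
    have dE: "\<delta> \<in> ?E"
      unfolding \<delta>_def using D by (intro cofinite_identitiesI) (auto simp: Diff_Diff_Int)
    have "?r \<epsilon> \<delta> \<or> ?r \<delta> \<epsilon>" if "\<epsilon> \<in> C" for \<epsilon>
      using comp[of "?h \<epsilon>"] that le[of \<epsilon> \<delta>] le[of \<delta> \<epsilon>] CE dE hd by auto
    then have "pred_on.chain ?E ?r (insert \<delta> C)"
      using ch dE unfolding pred_on.chain_def by auto
    then have "\<delta> \<in> C" using mx by blast
    then show "D \<in> ?h ` C" using hd by blast
  qed
  have "bij_betw ?h C (?h ` C)"
    using bij_betw_complement_dom CE by (meson bij_betw_subset subset_refl)
  then have bijC: "bij_betw (card \<circ> ?h) C UNIV"
    using bij by (rule bij_betw_trans)
  define g where "g = inv_into C (card \<circ> ?h)"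
  have g: "bij_betw g UNIV C"
    unfolding g_def using bijC by (rule bij_betw_inv_into)
  have card_g: "card (?h (g n)) = n" for n
    using bij_betw_inv_into_right[OF bijC, of n] by (simp add: g_def)
  have gC: "g n \<in> C" for n using g by (auto simp: bij_betw_def)
  have order: "?r (g m) (g n) \<longleftrightarrow> n \<le> m" for m n
  proof -
    have fin: "finite (?h (g k))" for k using F gC by blast
    have "?h (g n) \<subseteq> ?h (g m) \<longleftrightarrow> n \<le> m"
    proof
      assume "?h (g n) \<subseteq> ?h (g m)"
      then show "n \<le> m" using card_mono[OF fin] card_g by metis
    next
      assume "n \<le> m"
      then show "?h (g n) \<subseteq> ?h (g m)"
        using chain[of "?h (g n)" "?h (g m)"] gC card_g card_seteq[OF fin, of "?h (g m)" n]
        by (metis (no_types, lifting) image_eqI subset_refl)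
    qed
    then show ?thesis using le gC CE by blast
  qed
  \<comment> \<open>Chains are indexed from 1, cardinalities from 0.\<close>
  have "bij_betw (\<lambda>n. n - 1) Npos UNIV"
    by (rule bij_betw_byWitness[where f' = Suc]) auto
  then have "bij_betw (g \<circ> (\<lambda>n. n - 1)) Npos C"
    using g by (rule bij_betw_trans)
  moreover have "\<forall>m\<in>Npos. \<forall>n\<in>Npos. m \<ge> n \<longleftrightarrow>
      ?r ((g \<circ> (\<lambda>n. n - 1)) m) ((g \<circ> (\<lambda>n. n - 1)) n)"
    using order by auto
  ultimately show ?thesis unfolding omega_chain_def by blast
qed

section \<open>Partial isometries as partial translations\<close>

definition translates :: "int \<Rightarrow> nat set \<Rightarrow> nat set \<Rightarrow> bool"
  where "translates k A B \<longleftrightarrow> int ` B = (\<lambda>a. int a + k) ` A"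

definition translation :: "nat set \<Rightarrow> int \<Rightarrow> nat \<rightharpoonup> nat"
  where "translation A k = (\<lambda>x. if x \<in> A then Some (nat (int x + k)) else None)"

lemma is_shift_of_iff: "is_shift_of B A \<longleftrightarrow> (\<exists>k. translates k A B)"
  by (simp add: is_shift_of_def translates_def Setcompr_eq_image)

lemma translates_trans:
  assumes "translates k A B" "translates l B C"
  shows "translates (k + l) A C"
proof -
  have "int ` C = (\<lambda>b. b + l) ` int ` B"
    using assms(2) by (simp add: translates_def image_image)
  also have "\<dots> = (\<lambda>a. int a + (k + l)) ` A"
    using assms(1) by (simp add: translates_def image_image add.assoc)
  finally show ?thesis by (simp add: translates_def)
qed

lemma translates_sym:
  assumes "translates k A B"
  shows "translates (- k) B A"
proof -
  have "(\<lambda>b. b - k) ` int ` B = int ` A"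
    using assms by (simp add: translates_def image_image)
  then show ?thesis by (simp add: translates_def image_image)
qed

lemma is_shift_of_sym: "is_shift_of A B \<Longrightarrow> is_shift_of B A"
  unfolding is_shift_of_iff using translates_sym by blast

lemma is_shift_of_trans: "is_shift_of A B \<Longrightarrow> is_shift_of B C \<Longrightarrow> is_shift_of A C"
  unfolding is_shift_of_iff using translates_trans by blast

text \<open>The least element of \<open>A\<close> goes to the least element of \<open>B\<close>.\<close>

lemma translates_unique:
  assumes "translates k A B" "translates l A B" "A \<noteq> {}"
  shows "k = l"
proof -
  have le: "k \<le> l" if k: "translates k A B" and l: "translates l A B" for k l
  proof -
    let ?a = "LEAST a. a \<in> A"
    have a: "?a \<in> A" using assms(3) by (meson LeastI ex_in_conv)
    then have "int ?a + l \<in> int ` B" using l by (auto simp: translates_def)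
    then obtain a' where "a' \<in> A" "int ?a + l = int a' + k" using k by (auto simp: translates_def)
    moreover have "?a \<le> a'" using \<open>a' \<in> A\<close> by (rule Least_le)
    ultimately show ?thesis by linarith
  qed
  show ?thesis using le[OF assms(1,2)] le[OF assms(2,1)] by simp
qed

lemma translatesD:
  "translates k A B \<Longrightarrow> x \<in> A \<Longrightarrow>
    nat (int x + k) \<in> B \<and> int (nat (int x + k)) = int x + k"
proof -
  assume t: "translates k A B" and x: "x \<in> A"
  have "int x + k \<in> int ` B" using t x by (auto simp: translates_def)
  then show ?thesis by fastforce
qed

lemma dom_translation [simp]: "dom (translation A k) = A"
  by (auto simp: translation_def split: if_splits)

lemma ran_translation: "translates k A B \<Longrightarrow> ran (translation A k) = B"
proof -
  assume t: "translates k A B"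
  have "b \<in> (\<lambda>x. nat (int x + k)) ` A" if "b \<in> B" for b
  proof -
    have "int b \<in> (\<lambda>a. int a + k) ` A" using t that unfolding translates_def by blast
    then show ?thesis by force
  qed
  moreover have "ran (translation A k) = (\<lambda>x. nat (int x + k)) ` A"
    by (auto simp: ran_def translation_def)
  ultimately show ?thesis using translatesD[OF t] by auto
qed

lemma translation_comp:
  "translates k A B \<Longrightarrow> translation B l \<circ>\<^sub>m translation A k = translation A (k + l)"
  using translatesD[of k A B] by (auto simp: translation_def map_comp_def add.assoc)

lemma translation_in_carrier:
  assumes t: "translates k A B" and "A \<subseteq> Npos" "finite (Npos - A)" "B \<subseteq> Npos" "finite (Npos - B)"
  shows "translation A k \<in> carrier IN_inf"
proof -
  have "inj_on (translation A k) A"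
    by (rule inj_onI) (metis (no_types, lifting) translatesD[OF t] translation_def
        add_right_cancel of_nat_eq_iff option.sel)
  moreover have "partial_isometry (translation A k)"
    using translatesD[OF t] by (auto simp: partial_isometry_def translation_def)
  ultimately show ?thesis
    using assms ran_translation[OF t] by (simp add: carrier_IN_inf cofinite_pinj_def)
qed

text \<open>Fix a base point \<open>x\<^sub>0\<close> of the domain. A point \<open>z\<close> of the domain that is further from \<open>x\<^sub>0\<close>
  than the image of \<open>x\<^sub>0\<close> is from 0 has no room to the left of that image, so it is sent to the
  right. The distances to \<open>x\<^sub>0\<close> and to \<open>z\<close> then force each \<open>y\<close> to the left of \<open>z\<close> to keep its
  side of \<open>x\<^sub>0\<close>.\<close>

lemma carrier_IN_inf_translation:
  assumes "\<alpha> \<in> carrier IN_inf"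
  obtains k where "\<alpha> = translation (dom \<alpha>) k" "translates k (dom \<alpha>) (ran \<alpha>)"
proof -
  have iso: "\<bar>int (the (\<alpha> x)) - int (the (\<alpha> y))\<bar> = \<bar>int x - int y\<bar>"
    if "x \<in> dom \<alpha>" "y \<in> dom \<alpha>" for x y
    using assms that by (auto simp: carrier_IN_inf partial_isometry_def)
  have "finite (Npos - dom \<alpha>)"
    using assms by (auto simp: carrier_IN_inf cofinite_pinj_def)
  then have inf: "infinite (dom \<alpha>)"
    using infinite_Ici[of "1 :: nat"] finite_Diff2 by blast
  then obtain x0 where x0: "x0 \<in> dom \<alpha>" by fastforce
  define k where "k = int (the (\<alpha> x0)) - int x0"
  have val: "int (the (\<alpha> y)) = int y + k" if y: "y \<in> dom \<alpha>" for y
  proof -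
    obtain z where z: "z > x0 + y + the (\<alpha> x0)" "z \<in> dom \<alpha>"
      using inf by (metis finite_nat_set_iff_bounded_le not_le_imp_less)
    show ?thesis
      using iso[OF y x0] iso[OF z(2) x0] iso[OF z(2) y] z(1) unfolding k_def by linarith
  qed
  have eq: "\<alpha> = translation (dom \<alpha>) k"
  proof
    fix x
    show "\<alpha> x = translation (dom \<alpha>) k x"
      using val[of x] by (cases "\<alpha> x") (auto simp: translation_def domIff simp flip: val)
  qed
  have "ran \<alpha> = (\<lambda>x. the (\<alpha> x)) ` dom \<alpha>"
    by (force simp: ran_def dom_def image_def)
  then have "translates k (dom \<alpha>) (ran \<alpha>)"
    using val by (simp add: translates_def image_image)
  with eq show thesis by (rule that)
qed

lemma carrier_IN_inf_cofinite:
  assumes "\<alpha> \<in> carrier IN_inf"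
  shows "dom \<alpha> \<subseteq> Npos" "finite (Npos - dom \<alpha>)" "ran \<alpha> \<subseteq> Npos" "finite (Npos - ran \<alpha>)"
  using assms by (auto simp: carrier_IN_inf cofinite_pinj_def)

section \<open>Green's relations\<close>

lemma (in monoid) green_L_iff:
  assumes "a \<in> carrier G" "b \<in> carrier G"
  shows "(a, b) \<in> green_L G \<longleftrightarrow>
    (\<exists>u\<in>carrier G. a = b \<otimes> u) \<and> (\<exists>v\<in>carrier G. b = a \<otimes> v)" (is "_ \<longleftrightarrow> ?R")
proof
  have self: "c \<in> c <# carrier G" if "c \<in> carrier G" for c
    using that by (auto simp: l_coset_def intro!: bexI[of _ \<one>])
  assume "(a, b) \<in> green_L G"
  then have "a \<in> b <# carrier G" "b \<in> a <# carrier G"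
    using self assms by (auto simp: green_L_def)
  then show ?R by (auto simp: l_coset_def)
next
  have sub: "(c \<otimes> u) <# carrier G \<subseteq> c <# carrier G" if "c \<in> carrier G" "u \<in> carrier G" for c u
    using that by (fastforce simp: l_coset_def m_assoc)
  assume ?R
  then have "a <# carrier G = b <# carrier G" using sub assms by (metis subset_antisym)
  then show "(a, b) \<in> green_L G" using assms by (simp add: green_L_def)
qed

lemma (in monoid) green_R_iff:
  assumes "a \<in> carrier G" "b \<in> carrier G"
  shows "(a, b) \<in> green_R G \<longleftrightarrow>
    (\<exists>u\<in>carrier G. a = u \<otimes> b) \<and> (\<exists>v\<in>carrier G. b = v \<otimes> a)" (is "_ \<longleftrightarrow> ?R")
proof
  have self: "c \<in> carrier G #> c" if "c \<in> carrier G" for c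
    using that by (auto simp: r_coset_def intro!: bexI[of _ \<one>])
  assume "(a, b) \<in> green_R G"
  then have "a \<in> carrier G #> b" "b \<in> carrier G #> a"
    using self assms by (auto simp: green_R_def)
  then show ?R by (auto simp: r_coset_def)
next
  have sub: "carrier G #> (u \<otimes> c) \<subseteq> carrier G #> c" if "c \<in> carrier G" "u \<in> carrier G" for c u
    using that by (fastforce simp: r_coset_def simp flip: m_assoc)
  assume ?R
  then have "carrier G #> a = carrier G #> b" using sub assms by (metis subset_antisym)
  then show "(a, b) \<in> green_R G" using assms by (simp add: green_R_def)
qed

lemma right_factor_if_same_dom:
  assumes "\<alpha> \<in> carrier IN_inf" "\<beta> \<in> carrier IN_inf" "dom \<alpha> = dom \<beta>"
  shows "\<exists>\<gamma>\<in>carrier IN_inf. \<alpha> = \<beta> \<otimes>\<^bsub>IN_inf\<^esub> \<gamma>"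
proof -
  obtain k where k: "\<alpha> = translation (dom \<alpha>) k" "translates k (dom \<alpha>) (ran \<alpha>)"
    using assms(1) by (rule carrier_IN_inf_translation)
  obtain l where l: "\<beta> = translation (dom \<beta>) l" "translates l (dom \<beta>) (ran \<beta>)"
    using assms(2) by (rule carrier_IN_inf_translation)
  have "translates (- l + k) (ran \<beta>) (ran \<alpha>)"
    using translates_trans[OF translates_sym[OF l(2)]] k(2) assms(3) by simp
  then have "translation (ran \<beta>) (- l + k) \<in> carrier IN_inf"
    using carrier_IN_inf_cofinite assms by (intro translation_in_carrier)
  moreover have "\<alpha> = \<beta> \<otimes>\<^bsub>IN_inf\<^esub> translation (ran \<beta>) (- l + k)"
    using translation_comp[OF l(2), of "- l + k"] k(1) l(1) assms(3) by simp
  ultimately show ?thesis by blast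
qed

lemma left_factor_if_same_ran:
  assumes "\<alpha> \<in> carrier IN_inf" "\<beta> \<in> carrier IN_inf" "ran \<alpha> = ran \<beta>"
  shows "\<exists>\<gamma>\<in>carrier IN_inf. \<alpha> = \<gamma> \<otimes>\<^bsub>IN_inf\<^esub> \<beta>"
proof -
  obtain k where k: "\<alpha> = translation (dom \<alpha>) k" "translates k (dom \<alpha>) (ran \<alpha>)"
    using assms(1) by (rule carrier_IN_inf_translation)
  obtain l where l: "\<beta> = translation (dom \<beta>) l" "translates l (dom \<beta>) (ran \<beta>)"
    using assms(2) by (rule carrier_IN_inf_translation)
  have t: "translates (k + - l) (dom \<alpha>) (dom \<beta>)"
    using translates_trans[OF k(2), of "- l"] translates_sym[OF l(2)] assms(3) by simp
  then have "translation (dom \<alpha>) (k + - l) \<in> carrier IN_inf"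
    using carrier_IN_inf_cofinite assms by (intro translation_in_carrier)
  moreover have "\<alpha> = translation (dom \<alpha>) (k + - l) \<otimes>\<^bsub>IN_inf\<^esub> \<beta>"
    using translation_comp[OF t, of l] k(1) l(1) by simp
  ultimately show ?thesis by blast
qed

lemma green_L_iff_dom:
  assumes "\<alpha> \<in> carrier IN_inf" "\<beta> \<in> carrier IN_inf"
  shows "(\<alpha>, \<beta>) \<in> green_L IN_inf \<longleftrightarrow> dom \<alpha> = dom \<beta>"
proof -
  have "dom (\<delta> \<otimes>\<^bsub>IN_inf\<^esub> \<gamma>) \<subseteq> dom \<delta>" for \<gamma> \<delta>
    by (auto simp: map_comp_def split: option.splits)
  then show ?thesis
    unfolding monoid.green_L_iff[OF monoid_IN_inf assms]
    using right_factor_if_same_dom assms by (metis subset_antisym)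
qed

lemma green_R_iff_ran:
  assumes "\<alpha> \<in> carrier IN_inf" "\<beta> \<in> carrier IN_inf"
  shows "(\<alpha>, \<beta>) \<in> green_R IN_inf \<longleftrightarrow> ran \<alpha> = ran \<beta>"
proof -
  have "ran (\<gamma> \<otimes>\<^bsub>IN_inf\<^esub> \<delta>) \<subseteq> ran \<delta>" for \<gamma> \<delta>
    by (auto simp: map_comp_def ran_def split: option.splits)
  then show ?thesis
    unfolding monoid.green_R_iff[OF monoid_IN_inf assms]
    using left_factor_if_same_ran assms by (metis subset_antisym)
qed

lemma IN_inf_eqI:
  assumes "\<alpha> \<in> carrier IN_inf" "\<beta> \<in> carrier IN_inf" "dom \<alpha> = dom \<beta>" "ran \<alpha> = ran \<beta>"
  shows "\<alpha> = \<beta>"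
proof (cases "dom \<alpha> = {}")
  case True
  then show ?thesis using assms(3) by simp
next
  case False
  obtain k where k: "\<alpha> = translation (dom \<alpha>) k" "translates k (dom \<alpha>) (ran \<alpha>)"
    using assms(1) by (rule carrier_IN_inf_translation)
  obtain l where l: "\<beta> = translation (dom \<beta>) l" "translates l (dom \<beta>) (ran \<beta>)"
    using assms(2) by (rule carrier_IN_inf_translation)
  have "k = l" using translates_unique[OF k(2) _ False] l(2) assms(3,4) by simp
  then show ?thesis using k(1) l(1) assms(3) by simp
qed

lemma ran_is_shift_of_dom: "\<alpha> \<in> carrier IN_inf \<Longrightarrow> is_shift_of (ran \<alpha>) (dom \<alpha>)"
  unfolding is_shift_of_iff by (metis carrier_IN_inf_translation)

lemma green_D_iff_ran_dom:
  assumes "\<alpha> \<in> carrier IN_inf" "\<beta> \<in> carrier IN_inf"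
  shows "(\<alpha>, \<beta>) \<in> green_D IN_inf \<longleftrightarrow> is_shift_of (ran \<beta>) (dom \<alpha>)"
proof
  assume "(\<alpha>, \<beta>) \<in> green_D IN_inf"
  then obtain \<gamma> where \<gamma>: "(\<alpha>, \<gamma>) \<in> green_L IN_inf" "(\<gamma>, \<beta>) \<in> green_R IN_inf"
    by (auto simp: green_D_def)
  then have c: "\<gamma> \<in> carrier IN_inf" by (simp add: green_L_def)
  have "dom \<gamma> = dom \<alpha>" "ran \<gamma> = ran \<beta>"
    using \<gamma> green_L_iff_dom[OF assms(1) c] green_R_iff_ran[OF c assms(2)] by simp_all
  then show "is_shift_of (ran \<beta>) (dom \<alpha>)" using ran_is_shift_of_dom[OF c] by simp
next
  assume "is_shift_of (ran \<beta>) (dom \<alpha>)"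
  then obtain k where k: "translates k (dom \<alpha>) (ran \<beta>)" by (auto simp: is_shift_of_iff)
  let ?\<gamma> = "translation (dom \<alpha>) k"
  have c: "?\<gamma> \<in> carrier IN_inf"
    using k carrier_IN_inf_cofinite assms by (intro translation_in_carrier)
  have "(\<alpha>, ?\<gamma>) \<in> green_L IN_inf" using green_L_iff_dom[OF assms(1) c] by simp
  moreover have "(?\<gamma>, \<beta>) \<in> green_R IN_inf"
    using green_R_iff_ran[OF c assms(2)] ran_translation[OF k] by simp
  ultimately show "(\<alpha>, \<beta>) \<in> green_D IN_inf" by (auto simp: green_D_def)
qed

theorem mainTheorem1:
  shows
    "(idempotents IN_inf = idempotents Imon_inf \<and>
      (\<lambda>\<epsilon>. Npos - dom \<epsilon>) \<in> iso (idempotent_semilattice IN_inf) fin_subsets_monoid) \<and>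
     (\<forall>\<epsilon>\<in>idempotents IN_inf. \<forall>\<iota>\<in>idempotents IN_inf.
        natural_le IN_inf \<epsilon> \<iota> \<longleftrightarrow> dom \<epsilon> \<subseteq> dom \<iota>) \<and>
     (\<forall>C. pred_on.maxchain (idempotents IN_inf) (natural_le IN_inf) C \<longrightarrow>
        omega_chain (natural_le IN_inf) C) \<and>
     (\<forall>\<alpha>\<in>carrier IN_inf. \<forall>\<beta>\<in>carrier IN_inf.
        ((\<alpha>, \<beta>) \<in> green_L IN_inf \<longleftrightarrow> dom \<alpha> = dom \<beta>) \<and>
        ((\<alpha>, \<beta>) \<in> green_R IN_inf \<longleftrightarrow> ran \<alpha> = ran \<beta>) \<and>
        ((\<alpha>, \<beta>) \<in> green_H IN_inf \<longleftrightarrow> \<alpha> = \<beta>) \<and>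
        ((\<alpha>, \<beta>) \<in> green_D IN_inf \<longleftrightarrow> is_shift_of (dom \<alpha>) (dom \<beta>)) \<and>
        ((\<alpha>, \<beta>) \<in> green_D IN_inf \<longleftrightarrow> is_shift_of (ran \<alpha>) (ran \<beta>)))"
proof (intro conjI ballI allI impI)
  show "idempotents IN_inf = idempotents Imon_inf"
    by (simp add: idempotents_IN_inf idempotents_Imon_inf)
  show "(\<lambda>\<epsilon>. Npos - dom \<epsilon>) \<in> iso (idempotent_semilattice IN_inf) fin_subsets_monoid"
    by (rule complement_dom_iso)
  show "natural_le IN_inf \<epsilon> \<iota> \<longleftrightarrow> dom \<epsilon> \<subseteq> dom \<iota>"
    if "\<epsilon> \<in> idempotents IN_inf" "\<iota> \<in> idempotents IN_inf" for \<epsilon> \<iota>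
    using that natural_le_iff_dom_subset by (simp add: idempotents_IN_inf)
  show "omega_chain (natural_le IN_inf) C"
    if "pred_on.maxchain (idempotents IN_inf) (natural_le IN_inf) C" for C
    using that maxchain_idempotents_omega_chain by (simp add: idempotents_IN_inf)
  fix \<alpha> \<beta> assume c: "\<alpha> \<in> carrier IN_inf" "\<beta> \<in> carrier IN_inf"
  note shifts = ran_is_shift_of_dom[OF c(1)] ran_is_shift_of_dom[OF c(2)]
  show "(\<alpha>, \<beta>) \<in> green_L IN_inf \<longleftrightarrow> dom \<alpha> = dom \<beta>" using c by (rule green_L_iff_dom)
  show "(\<alpha>, \<beta>) \<in> green_R IN_inf \<longleftrightarrow> ran \<alpha> = ran \<beta>" using c by (rule green_R_iff_ran)
  show "(\<alpha>, \<beta>) \<in> green_H IN_inf \<longleftrightarrow> \<alpha> = \<beta>"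
    using green_L_iff_dom[OF c] green_R_iff_ran[OF c] IN_inf_eqI[OF c]
    by (auto simp: green_H_def)
  show "(\<alpha>, \<beta>) \<in> green_D IN_inf \<longleftrightarrow> is_shift_of (dom \<alpha>) (dom \<beta>)"
    unfolding green_D_iff_ran_dom[OF c]
    using shifts by (meson is_shift_of_sym is_shift_of_trans)
  show "(\<alpha>, \<beta>) \<in> green_D IN_inf \<longleftrightarrow> is_shift_of (ran \<alpha>) (ran \<beta>)"
    unfolding green_D_iff_ran_dom[OF c]
    using shifts by (meson is_shift_of_sym is_shift_of_trans)
qed

end
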